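(* Let $q$ be a power of a prime $p$, let $A\in \mathbb{F}_q[X]$ be an additive polynomial that is not of the form $aX^{p^h}$ (with $a\in\mathbb{F}_q$, $h\ge 0$), fix $b\in \mathbb{F}_q$ and set $B(X)=A(X)+b$. Then there exist real numbers $\alpha_B, \beta_B>0$ such that $\frac{\rho_B(n)}{n}\in [\alpha_B, \beta_B]$ for every integer $n\ge 1$.
   Context: $\mathbb{F}_q$ denotes the finite field with $q$ elements. A polynomial $f\in\mathbb{F}_q[X]$ is additive if $f(X+Y)=f(X)+f(Y)$ in $\mathbb{F}_q[X,Y]$; equivalently, with $p$ the characteristic, $f=\sum_{i=0}^h a_iX^{p^i}$ with $a_i\in\mathbb{F}_q$. For a polynomial $F$ and $n\ge 1$, $F^{(n)}(X)$ denotes the $n$-fold composition of $F$ with itself. For a nonconstant $F\in\mathbb{F}_q[X]$ and $n\ge 1$, let $N_F(n)$ be the number of distinct irreducible factors of $F^{(n)}(X)$ over $\mathbb{F}_q$ (counted without multiplicity, up to scalars); if $f_{1,n},\ldots,f_{N_F(n),n}\in\mathbb{F}_q[X]$ are these distinct irreducible factors, set $$\rho_F(n)=\frac{1}{N_F(n)}\sum_{i=1}^{N_F(n)}\deg(f_{i,n}),$$ the average degree of the distinct irreducible factors. *)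

theory Defs
  imports "HOL-Computational_Algebra.Computational_Algebra" "HOL-Library.Cardinality"
begin

text \<open>
  The ring \<open>F[X,Y]\<close> is represented as \<open>F[X][Y]\<close>, i.e. \<open>'a poly poly\<close>: the outer variable
  is \<open>Y = [:0, 1:]\<close> and \<open>X = [:[:0, 1:]:]\<close>, so \<open>X + Y = [:[:0, 1:], 1:]\<close>. Mapping
  \<open>\<lambda>c. [:c:]\<close> over the coefficients of \<open>f\<close> gives \<open>f(Y)\<close>, while \<open>[:f:]\<close> is \<open>f(X)\<close>.
\<close>

definition additive_poly :: "'a::field poly \<Rightarrow> bool" where
  "additive_poly f \<longleftrightarrow>
     pcompose (map_poly (\<lambda>c. [:c:]) f) [:[:0, 1:], 1:] = [:f:] + map_poly (\<lambda>c. [:c:]) f"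

definition poly_iterate :: "'a::field poly \<Rightarrow> nat \<Rightarrow> 'a poly" where
  "poly_iterate F n = (pcompose F ^^ n) [:0, 1:]"

text \<open>Irreducible factors up to scalars are represented by their monic associates.\<close>

definition irreducible_factors :: "'a::field poly \<Rightarrow> 'a poly set" where
  "irreducible_factors F = {f. irreducible f \<and> lead_coeff f = 1 \<and> f dvd F}"

definition num_irreducible_factors :: "'a::field poly \<Rightarrow> nat \<Rightarrow> nat" where
  "num_irreducible_factors F n = card (irreducible_factors (poly_iterate F n))"

definition avg_factor_degree :: "'a::field poly \<Rightarrow> nat \<Rightarrow> real" where
  "avg_factor_degree F n =
     1 / real (num_irreducible_factors F n) *
       (\<Sum>f\<in>irreducible_factors (poly_iterate F n). real (degree f))"

end

theory Submission
  imports "HOL-Algebra.Algebraic_Closure_Type" Defs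
begin

text \<open>
  Let \<open>D\<close> be the sum of the degrees of the distinct irreducible factors of \<open>B\<^sup>(\<^sup>n\<^sup>)\<close>. In the algebraic
  closure every fibre of \<open>B\<close> is a coset of \<open>ker A\<close>, which is nontrivial because \<open>A\<close> is not a monomial;
  hence \<open>B\<^sup>(\<^sup>n\<^sup>)\<close> has at least \<open>2\<^sup>n\<close> distinct roots and \<open>D \<ge> 2\<^sup>n\<close>. For small \<open>c > 0\<close> there are only
  \<open>O(2\<^bsup>n/2\<^esup>)\<close> polynomials of degree at most \<open>cn\<close>, and at most \<open>D/(cn)\<close> factors of larger degree, so there are
  \<open>O(D/n)\<close> factors in total.

  For the upper bound, some power \<open>\<sigma> = \<phi>\<^sup>e\<close> of the \<open>q\<close>-Frobenius \<open>\<phi>\<close> is the identity on the finite group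
  \<open>ker A\<close>. Since \<open>\<sigma>\<close> commutes with \<open>A\<close>, the map \<open>(\<sigma> - 1)\<^sup>n\<close> vanishes on \<open>ker A\<^sup>n\<close>. If \<open>x\<close> is a root of
  \<open>B\<^sup>(\<^sup>n\<^sup>)\<close>, then so is \<open>\<sigma> x\<close>, so \<open>\<sigma> x - x \<in> ker A\<^sup>n\<close> and \<open>(\<sigma> - 1)\<^bsup>n+1\<^esup> x = 0\<close>. In characteristic \<open>p\<close> this
  gives \<open>\<sigma>\<^bsup>r\<^esup> x = x\<close> for the least power \<open>r\<close> of \<open>p\<close> exceeding \<open>n\<close>, so \<open>x\<close> has degree at most \<open>er \<le> epn\<close>.
\<close>

section \<open>Finite fields\<close>

text \<open>Multiplication by a nonzero \<open>x\<close> permutes the nonzero elements; cancelling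
  their product leaves \<open>x ^ (CARD('a) - 1) = 1\<close>.\<close>

lemma power_CARD_eq_same:
  fixes x :: "'a::{field,finite}"
  shows "x ^ CARD('a) = x"
proof (cases "x = 0")
  case False
  have "(\<Prod>y\<in>UNIV-{0}. x * y) = (\<Prod>y\<in>UNIV-{0}. y)"
    by (rule prod.reindex_bij_witness[of _ "\<lambda>y. y / x" "\<lambda>y. x * y"]) (use False in auto)
  hence "x ^ (CARD('a) - 1) * \<Prod>(UNIV-{0}) = 1 * \<Prod>(UNIV-{0})"
    by (simp add: prod.distrib)
  hence "x ^ (CARD('a) - 1) = 1"
    by (subst (asm) mult_right_cancel) auto
  moreover have "x ^ CARD('a) = x * x ^ (CARD('a) - 1)"
    by (simp flip: power_Suc)
  ultimately show ?thesis
    by simp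
qed auto

text \<open>Translation by 1 permutes the field, so summing all elements shows that its order is
  zero in the field; the prime characteristic therefore divides \<open>p ^ m\<close>.\<close>

lemma CHAR_eq_of_CARD:
  assumes "prime p" "CARD('a::{field,finite}) = p ^ m"
  shows "CHAR('a) = p"
proof -
  have "prime CHAR('a)"
    by (intro prime_CHAR_semidom finite_imp_CHAR_pos) auto
  moreover have "of_nat (CARD('a)) = (0 :: 'a)"
  proof -
    have "sum (\<lambda>x::'a. x + 1) UNIV = sum (\<lambda>x. x) UNIV"
      by (rule sum.reindex_bij_witness[of _ "\<lambda>x. x - 1" "\<lambda>x. x + 1"]) auto
    thus ?thesis by (simp add: sum.distrib)
  qed
  hence "CHAR('a) dvd p ^ m"
    by (simp only: assms(2) of_nat_eq_0_iff_char_dvd)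
  ultimately show ?thesis
    using assms(1) prime_dvd_power primes_dvd_imp_eq by blast
qed

text \<open>Such polynomials correspond to coefficient lists of length \<open>d\<close>. At
  \<open>d = 0\<close> the set would be empty, since \<open>degree 0 = 0\<close>, whereas the power
  would be 1.\<close>

lemma card_poly_degree_less:
  assumes "d > 0"
  shows "card {u :: 'a::{zero,finite} poly. degree u < d} = CARD('a) ^ d"
proof -
  have "bij_betw Poly {xs :: 'a list. set xs \<subseteq> UNIV \<and> length xs = d} {u. degree u < d}"
  proof (rule bij_betw_byWitness[where f' = "\<lambda>u. map (coeff u) [0..<d]"])
    show "\<forall>xs\<in>{xs :: 'a list. set xs \<subseteq> UNIV \<and> length xs = d}. map (coeff (Poly xs)) [0..<d] = xs"
      by (auto intro!: nth_equalityI simp: nth_default_def)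
    show "\<forall>u\<in>{u :: 'a poly. degree u < d}. Poly (map (coeff u) [0..<d]) = u"
      by (auto intro!: poly_eqI simp: nth_default_def coeff_eq_0)
    show "Poly ` {xs :: 'a list. set xs \<subseteq> UNIV \<and> length xs = d} \<subseteq> {u. degree u < d}"
    proof (intro image_subsetI CollectI)
      fix xs :: "'a list"
      assume "xs \<in> {xs. set xs \<subseteq> UNIV \<and> length xs = d}"
      hence "degree (Poly xs) \<le> d - 1"
        by (intro degree_le) (auto simp: nth_default_def)
      thus "degree (Poly xs) < d"
        using assms by linarith
    qed
  qed auto
  hence "card {u :: 'a poly. degree u < d} = card {xs :: 'a list. set xs \<subseteq> UNIV \<and> length xs = d}"
    by (simp add: bij_betw_same_card)
  thus ?thesis
    by (simp only: card_lists_length_eq finite)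
qed

lemma finite_poly_degree_less: "finite {u :: 'a::{zero,finite} poly. degree u < d}"
proof (cases "d = 0")
  case False
  hence "card {u :: 'a poly. degree u < d} > 0"
    by (simp add: card_poly_degree_less)
  thus ?thesis
    by (rule card_ge_0_finite)
qed auto

text \<open>Euclid-style: over a finite field, the product of all \<open>X - a\<close>, plus 1, has
  no root. This later turns identities between values into identities between polynomials.\<close>

lemma infinite_UNIV_alg_closed: "infinite (UNIV :: 'a::alg_closed_field set)"
proof
  assume fin: "finite (UNIV :: 'a set)"
  define P :: "'a poly" where "P = (\<Prod>a\<in>UNIV. [:-a, 1:]) + 1"
  have "degree (\<Prod>a\<in>UNIV. [:-a, 1:] :: 'a poly) = CARD('a)"
    by (subst degree_prod_sum_eq) auto
  moreover have "CARD('a) > 0"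
    using fin by (simp add: finite_UNIV_card_ge_0)
  ultimately have "degree P > 0"
    unfolding P_def by (subst degree_add_eq_left) auto
  then obtain x where "poly P x = 0"
    using alg_closed_imp_poly_has_root by blast
  moreover have "poly (\<Prod>a\<in>UNIV. [:-a, 1:]) x = 0"
    using fin by (auto simp: poly_prod prod_zero_iff)
  ultimately show False
    by (simp add: P_def)
qed

section \<open>Prime characteristic\<close>

text \<open>Compare coefficients in (1 + X)^(p^k) = 1 + X^(p^k).\<close>

lemma of_nat_choose_CHAR_power:
  assumes "prime CHAR('a::comm_ring_1)" "0 < i" "i < CHAR('a) ^ k"
  shows "of_nat ((CHAR('a) ^ k) choose i) = (0 :: 'a)"
proof -
  have "of_nat ((CHAR('a) ^ k) choose i) = coeff ([:1, 1 :: 'a:] ^ (CHAR('a) ^ k)) i"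
    using assms by (subst coeff_linear_poly_power) auto
  also have "[:1, 1 :: 'a:] = 1 + monom 1 1"
    by (simp add: monom_altdef one_pCons)
  also have "(1 + monom 1 1 :: 'a poly) ^ (CHAR('a) ^ k) = 1 + monom 1 (CHAR('a) ^ k)"
    using assms(1) by (subst freshmans_dream'[where n = k]) (auto simp: monom_power)
  finally show ?thesis
    using assms by simp
qed

lemma power_CHAR_power_inj:
  fixes y z :: "'a::idom"
  assumes "prime CHAR('a)" "y ^ (CHAR('a) ^ k) = z ^ (CHAR('a) ^ k)"
  shows "y = z"
proof -
  have "((y - z) + z) ^ (CHAR('a) ^ k) = (y - z) ^ (CHAR('a) ^ k) + z ^ (CHAR('a) ^ k)"
    using assms(1) by (rule freshmans_dream') auto
  hence "(y - z) ^ (CHAR('a) ^ k) = 0"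
    using assms(2) by simp
  thus ?thesis
    by simp
qed

text \<open>Split off the p-part, \<open>j = p^h * t\<close>. Injectivity of the p^h-th power leaves
  (x + 1)^t = x^t + 1 for all x, hence as polynomials; if t were not 1, the coefficient t of X would
  have to vanish, although p does not divide t.\<close>

lemma additive_power_imp_CHAR_power:
  assumes "prime CHAR('a::alg_closed_field)"
    and add: "\<And>x y :: 'a. (x + y) ^ j = x ^ j + y ^ j"
  shows "\<exists>h. j = CHAR('a) ^ h"
proof -
  let ?p = "CHAR('a)"
  \<comment> \<open>As \<open>0 ^ 0 = 1\<close>, exponent 0 would give 1 = 1 + 1.\<close>
  have "j \<noteq> 0"
    using add[of 0 0] by (metis add_cancel_right_right one_neq_zero power_0)
  then obtain h t where j: "j = ?p ^ h * t" and t: "\<not> ?p dvd t"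
    using assms(1) not_prime_unit by (elim multiplicity_decompose'[of j ?p]) auto
  have *: "(x + 1) ^ t = x ^ t + 1" for x :: 'a
  proof (rule power_CHAR_power_inj[where k = h])
    have "((x + 1) ^ t) ^ ?p ^ h = (x ^ t) ^ ?p ^ h + 1 ^ ?p ^ h"
      using add[of x 1] by (simp add: j power_mult[symmetric] mult.commute)
    also have "\<dots> = (x ^ t + 1) ^ ?p ^ h"
      using assms(1) by (intro freshmans_dream'[symmetric]) auto
    finally show "((x + 1) ^ t) ^ ?p ^ h = (x ^ t + 1) ^ ?p ^ h" .
  qed (fact assms)
  have eq: "[:1, 1 :: 'a:] ^ t = monom 1 t + 1"
  proof (rule ccontr)
    assume "\<not> ?thesis"
    hence "finite {x. poly ([:1, 1 :: 'a:] ^ t - (monom 1 t + 1)) x = 0}"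
      by (intro poly_roots_finite) auto
    also have "{x. poly ([:1, 1 :: 'a:] ^ t - (monom 1 t + 1)) x = 0} = UNIV"
      using * by (simp add: poly_monom add.commute)
    finally show False
      using infinite_UNIV_alg_closed[where 'a = 'a] by simp
  qed
  have "t = 1"
  proof (rule ccontr)
    assume "t \<noteq> 1"
    moreover have "t \<noteq> 0"
      using t by (intro notI) simp
    ultimately have "coeff ([:1, 1 :: 'a:] ^ t) 1 = 0"
      unfolding eq by simp
    hence "of_nat t = (0 :: 'a)"
      using \<open>t \<noteq> 0\<close> by (subst (asm) coeff_linear_poly_power) auto
    thus False
      using t by (simp add: of_nat_eq_0_iff_char_dvd)
  qed
  thus ?thesis
    using j by auto
qed

section \<open>Additive maps\<close>

lemma additive_of_nat_mult:
  fixes \<sigma> :: "'a::comm_ring_1 \<Rightarrow> 'a"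
  assumes "\<And>x y. \<sigma> (x + y) = \<sigma> x + \<sigma> y"
  shows "\<sigma> (of_nat c * x) = of_nat c * \<sigma> x"
proof (induction c)
  case 0
  show ?case using assms[of 0 0] by simp
qed (simp add: algebra_simps assms)

lemma additive_sum:
  fixes \<sigma> :: "'a::ab_group_add \<Rightarrow> 'b::ab_group_add"
  assumes "\<And>x y. \<sigma> (x + y) = \<sigma> x + \<sigma> y"
  shows "\<sigma> (sum f A) = (\<Sum>i\<in>A. \<sigma> (f i))"
proof -
  have "\<sigma> 0 = 0"
    using assms[of 0 0] by simp
  thus ?thesis
    by (induction A rule: infinite_finite_induct) (auto simp: assms)
qed

lemma additive_diff:
  fixes \<sigma> :: "'a::ab_group_add \<Rightarrow> 'b::ab_group_add"
  assumes "\<And>x y. \<sigma> (x + y) = \<sigma> x + \<sigma> y"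
  shows "\<sigma> (x - y) = \<sigma> x - \<sigma> y"
  using assms[of "x - y" y] by simp

text \<open>This is the binomial theorem for \<sigma> = 1 + (\<sigma> - 1) in the ring of additive
  maps.\<close>

lemma funpow_additive_binomial:
  fixes \<sigma> :: "'a::comm_ring_1 \<Rightarrow> 'a"
  assumes "\<And>x y. \<sigma> (x + y) = \<sigma> x + \<sigma> y"
  shows "(\<sigma> ^^ j) x = (\<Sum>i\<le>j. of_nat (j choose i) * ((\<lambda>y. \<sigma> y - y) ^^ i) x)"
proof (induction j)
  case (Suc j)
  define t where "t i = ((\<lambda>y. \<sigma> y - y) ^^ i) x" for i
  have t: "\<sigma> (t i) = t (Suc i) + t i" for i
    by (simp add: t_def)
  have "(\<sigma> ^^ Suc j) x = \<sigma> (\<Sum>i\<le>j. of_nat (j choose i) * t i)"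
    using Suc.IH by (simp add: t_def)
  also have "\<dots> = (\<Sum>i\<le>j. of_nat (j choose i) * \<sigma> (t i))"
    using assms by (simp add: additive_sum additive_of_nat_mult)
  \<comment> \<open>The second sum may run to \<open>Suc j\<close> because
    \<open>j choose Suc j = 0\<close>; after an index shift, Pascal's rule applies.\<close>
  also have "\<dots> = (\<Sum>i\<le>j. of_nat (j choose i) * t (Suc i)) + (\<Sum>i\<le>Suc j. of_nat (j choose i) * t i)"
    by (simp add: t algebra_simps sum.distrib binomial_eq_0)
  also have "\<dots> = (\<Sum>i\<le>Suc j. of_nat (Suc j choose i) * t i)"
    by (subst (1 2) sum.atMost_Suc_shift) (simp add: algebra_simps sum.distrib binomial_eq_0 del: sum.atMost_Suc)
  finally show ?case
    by (simp only: t_def)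
qed auto

text \<open>In the expansion of (1 + (\<sigma> - 1))^(p^k) the middle coefficients vanish in
  characteristic p, and the top term vanishes because \<open>n \<le> p^k\<close>.\<close>

lemma funpow_CHAR_power_fixed:
  fixes \<sigma> :: "'a::comm_ring_1 \<Rightarrow> 'a"
  assumes "prime CHAR('a)" "\<And>x y. \<sigma> (x + y) = \<sigma> x + \<sigma> y"
    and "((\<lambda>y. \<sigma> y - y) ^^ n) x = 0" "n \<le> CHAR('a) ^ k"
  shows "(\<sigma> ^^ (CHAR('a) ^ k)) x = x"
proof -
  let ?\<psi> = "\<lambda>y. \<sigma> y - y" and ?N = "CHAR('a) ^ k"
  have "?N > 0"
    using assms(1) by (simp add: prime_gt_0_nat)
  have "\<sigma> 0 = 0"
    using assms(2)[of 0 0] by simp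
  hence "(?\<psi> ^^ i) 0 = 0" for i
    by (induction i) auto
  moreover have "(?\<psi> ^^ (?N - n + n)) x = (?\<psi> ^^ (?N - n)) ((?\<psi> ^^ n) x)"
    by (simp only: funpow_add o_apply)
  ultimately have top: "(?\<psi> ^^ ?N) x = 0"
    using assms(3,4) by simp
  have "(\<sigma> ^^ ?N) x = (\<Sum>i\<le>?N. of_nat (?N choose i) * (?\<psi> ^^ i) x)"
    using assms(2) by (rule funpow_additive_binomial)
  also have "\<dots> = (\<Sum>i\<in>{0}. of_nat (?N choose i) * (?\<psi> ^^ i) x)"
  proof (intro sum.mono_neutral_right ballI)
    fix i assume "i \<in> {..?N} - {0}"
    hence "i = ?N \<or> (0 < i \<and> i < ?N)"
      by auto
    thus "of_nat (?N choose i) * (?\<psi> ^^ i) x = 0"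
      using top of_nat_choose_CHAR_power[OF assms(1)] by auto
  qed auto
  finally show ?thesis
    by simp
qed

text \<open>\<sigma> - 1 maps the kernel of G^(n+1) into that of G^n: if z lies in the former, G^n z
  lies in the kernel of G, where \<sigma> is the identity, and \<sigma> commutes with G.\<close>

lemma funpow_kernel_nilpotent:
  fixes G \<sigma> :: "'a::ab_group_add \<Rightarrow> 'a"
  assumes "\<And>x y. G (x + y) = G x + G y" "\<And>x. G (\<sigma> x) = \<sigma> (G x)"
    and "\<And>z. G z = 0 \<Longrightarrow> \<sigma> z = z" "(G ^^ n) z = 0"
  shows "((\<lambda>y. \<sigma> y - y) ^^ n) z = 0"
  using assms(4)
proof (induction n arbitrary: z)
  case (Suc n)
  have add: "(G ^^ k) (x - y) = (G ^^ k) x - (G ^^ k) y" for k x y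
    by (induction k) (auto simp: additive_diff assms(1))
  have comm: "(G ^^ k) (\<sigma> x) = \<sigma> ((G ^^ k) x)" for k x
    by (induction k) (auto simp: assms(2))
  have "\<sigma> ((G ^^ n) z) = (G ^^ n) z"
    using Suc.prems by (intro assms(3)) simp
  hence "(G ^^ n) (\<sigma> z - z) = 0"
    by (simp add: add comm)
  thus ?case
    using Suc.IH by (simp add: funpow_swap1 funpow_Suc_right del: funpow.simps)
qed auto

lemma finite_inj_on_funpow_id:
  assumes "finite V" "inj_on f V" "f ` V \<subseteq> V"
  shows "\<exists>e>0. \<forall>v\<in>V. (f ^^ e) v = v"
proof -
  have maps: "(f ^^ i) v \<in> V" if "v \<in> V" for i v
    using assms(3) that by (induction i) auto
  have inj: "inj_on (f ^^ i) V" for i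
    using assms(2) maps by (induction i) (auto simp: inj_on_def)
  \<comment> \<open>Restricted to \<open>V\<close>, the iterates lie in a finite function space, so
    two of them coincide; injectivity then cancels the smaller one.\<close>
  define g where "g i = restrict (f ^^ i) V" for i
  have "range g \<subseteq> V \<rightarrow>\<^sub>E V"
    using maps by (auto simp: g_def)
  hence "finite (range g)"
    by (rule finite_subset) (simp add: finite_PiE assms(1))
  hence "\<not> inj g"
    using finite_imageD[of g UNIV] by auto
  then obtain i j where ij: "i < j" "g i = g j"
    by (metis injI linorder_neqE_nat)
  have "(f ^^ (j - i)) v = v" if "v \<in> V" for v
  proof (rule inj_onD[OF inj[of i]])
    have "(f ^^ i) ((f ^^ (j - i)) v) = (f ^^ (i + (j - i))) v"
      by (simp only: funpow_add o_apply)
    thus "(f ^^ i) ((f ^^ (j - i)) v) = (f ^^ i) v"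
      using fun_cong[OF ij(2), of v] ij(1) that by (simp add: g_def)
  qed (use maps that in auto)
  thus ?thesis
    using ij(1) by (intro exI[of _ "j - i"]) auto
qed

section \<open>Evaluation in the algebraic closure\<close>

text \<open>The map \<open>h\<close> is kept general: it will be both the embedding
  \<open>to_ac\<close> and the evaluation of coefficients that are themselves polynomials.\<close>

lemma poly_map_poly_add:
  fixes h :: "'b::comm_ring_1 \<Rightarrow> 'c::comm_ring_1"
  assumes "h 0 = 0" "\<And>a b. h (a + b) = h a + h b"
  shows "poly (map_poly h (f + g)) y = poly (map_poly h f) y + poly (map_poly h g) y"
proof -
  have "map_poly h (f + g) = map_poly h f + map_poly h g"
    by (intro poly_eqI) (simp add: coeff_map_poly assms)
  thus ?thesis by simp
qed

lemma poly_map_poly_mult: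
  fixes h :: "'b::comm_ring_1 \<Rightarrow> 'c::comm_ring_1"
  assumes "h 0 = 0" "\<And>a b. h (a + b) = h a + h b" "\<And>a b. h (a * b) = h a * h b"
  shows "poly (map_poly h (f * g)) y = poly (map_poly h f) y * poly (map_poly h g) y"
proof (induction f)
  case (pCons a f)
  have "map_poly h (smult a g) = smult (h a) (map_poly h g)"
    by (intro poly_eqI) (simp add: coeff_map_poly assms)
  thus ?case
    using pCons.IH
    by (simp add: poly_map_poly_add map_poly_pCons assms algebra_simps)
qed auto

definition ac_eval :: "'a::field poly \<Rightarrow> 'a alg_closure \<Rightarrow> 'a alg_closure" where
  "ac_eval f x = poly (map_poly to_ac f) x"

lemma ac_eval_0 [simp]: "ac_eval 0 x = 0"
  by (simp add: ac_eval_def)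

lemma ac_eval_1 [simp]: "ac_eval 1 x = 1"
  by (simp add: ac_eval_def)

lemma ac_eval_pCons [simp]: "ac_eval (pCons a f) x = to_ac a + x * ac_eval f x"
  by (simp add: ac_eval_def map_poly_pCons)

lemma ac_eval_add [simp]: "ac_eval (f + g) x = ac_eval f x + ac_eval g x"
  by (simp add: ac_eval_def poly_map_poly_add)

lemma ac_eval_mult [simp]: "ac_eval (f * g) x = ac_eval f x * ac_eval g x"
  by (simp add: ac_eval_def poly_map_poly_mult)

lemma ac_eval_diff [simp]: "ac_eval (f - g) x = ac_eval f x - ac_eval g x"
  using ac_eval_add[of "f - g" g x] by simp

lemma ac_eval_smult [simp]: "ac_eval (smult c f) x = to_ac c * ac_eval f x"
  using ac_eval_mult[of "[:c:]" f x] by simp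

lemma ac_eval_monom: "ac_eval (monom c n) x = to_ac c * x ^ n"
  by (simp add: ac_eval_def map_poly_monom poly_monom)

lemma ac_eval_pcompose: "ac_eval (pcompose f g) x = ac_eval f (ac_eval g x)"
  by (induction f) (simp_all add: pcompose_pCons)

lemma ac_eval_poly_iterate: "ac_eval (poly_iterate F n) x = (ac_eval F ^^ n) x"
  by (induction n) (simp_all add: poly_iterate_def ac_eval_pcompose)

lemma finite_ac_eval_roots: "f \<noteq> 0 \<Longrightarrow> finite {x. ac_eval f x = 0}"
  unfolding ac_eval_def by (intro poly_roots_finite) (simp add: map_poly_eq_0_iff)

lemma card_ac_eval_roots_le: "f \<noteq> 0 \<Longrightarrow> card {x. ac_eval f x = 0} \<le> degree f"
  unfolding ac_eval_def
  using card_poly_roots_bound[of "map_poly to_ac f"]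
  by (simp add: map_poly_eq_0_iff degree_map_poly)

lemma ac_eval_surj:
  assumes "degree f > 0"
  shows "\<exists>x. ac_eval f x = y"
proof -
  have "degree (map_poly to_ac f + [:- y:]) > 0"
    using assms by (subst degree_add_eq_left) (auto simp: degree_map_poly)
  then obtain x where "poly (map_poly to_ac f + [:- y:]) x = 0"
    using alg_closed_imp_poly_has_root by blast
  thus ?thesis
    by (auto simp: ac_eval_def)
qed

text \<open>The formal identity in F[X,Y] is specialised at a point of the algebraic
  closure.\<close>

lemma additive_poly_ac_eval:
  assumes "additive_poly f"
  shows "ac_eval f (x + y) = ac_eval f x + ac_eval f y"
proof -
  \<comment> \<open>\<open>H\<close> is the ring homomorphism sending the inner variable X to
    \<open>x\<close> and the outer variable Y to \<open>y\<close>.\<close>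
  define H where "H F = poly (map_poly (\<lambda>c. ac_eval c x) F) y" for F
  have H_add: "H (F + G) = H F + H G" for F G
    by (simp add: H_def poly_map_poly_add)
  have H_mult: "H (F * G) = H F * H G" for F G
    by (simp add: H_def poly_map_poly_mult)
  have H_0: "H 0 = 0"
    by (simp add: H_def)
  have H_pCons: "H (pCons c F) = ac_eval c x + y * H F" for c F
    by (simp add: H_def map_poly_pCons)
  have H_smult: "H (Polynomial.smult c F) = ac_eval c x * H F" for c F
    using H_mult[of "[:c:]" F] by (simp add: H_pCons H_0)
  have lhs: "H (pcompose (map_poly (\<lambda>c. [:c:]) g) [:[:0, 1:], 1:]) = ac_eval g (x + y)" for g
    by (induction g)
       (simp_all add: map_poly_pCons pcompose_pCons H_add H_smult H_pCons H_0 algebra_simps)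
  have rhs: "H (map_poly (\<lambda>c. [:c:]) g) = ac_eval g y" for g
    by (induction g) (simp_all add: map_poly_pCons H_pCons H_0)
  have "ac_eval f (x + y) = H ([:f:] + map_poly (\<lambda>c. [:c:]) f)"
    using assms lhs[of f] by (simp add: additive_poly_def)
  also have "\<dots> = ac_eval f x + ac_eval f y"
    by (simp add: H_add H_pCons H_0 rhs)
  finally show ?thesis .
qed

lemma prime_CHAR_finite: "prime CHAR('a::{field,finite})"
  by (intro prime_CHAR_semidom finite_imp_CHAR_pos) auto

text \<open>The q-Frobenius is additive and multiplicative and fixes the coefficients of
  \<open>f\<close>.\<close>

lemma ac_eval_power_CARD:
  fixes f :: "'a::{field,finite} poly"
  assumes "CARD('a) = CHAR('a) ^ m"
  shows "ac_eval f x ^ CARD('a) = ac_eval f (x ^ CARD('a))"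
proof (induction f)
  case (pCons a f)
  have "(to_ac a + x * ac_eval f x) ^ CARD('a) = to_ac a ^ CARD('a) + (x * ac_eval f x) ^ CARD('a)"
    by (rule freshmans_dream'[where n = m]) (use assms prime_CHAR_finite in auto)
  thus ?case
    using pCons.IH by (simp add: power_mult_distrib power_CARD_eq_same flip: to_ac_power)
qed auto

section \<open>Minimal polynomials of elements of the algebraic closure\<close>

lemma irreducible_factor_with_root:
  assumes "F \<noteq> 0" "ac_eval F x = 0"
  obtains f where "f \<in> irreducible_factors F" "ac_eval f x = 0"
    "\<And>g. ac_eval g x = 0 \<Longrightarrow> f dvd g"
proof -
  let ?P = "\<lambda>f. f \<noteq> 0 \<and> ac_eval f x = 0"
  \<comment> \<open>Scaled to be monic, a nonzero polynomial of least degree vanishing at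
    \<open>x\<close> is the minimal polynomial: division with remainder gives divisibility, and
    minimality of the degree gives irreducibility.\<close>
  obtain d where d: "d \<noteq> 0" "ac_eval d x = 0"
    and min: "\<And>g. g \<noteq> 0 \<Longrightarrow> ac_eval g x = 0 \<Longrightarrow> degree d \<le> degree g"
    using arg_min_natI[of ?P F degree] arg_min_nat_le[of ?P _ degree] assms by blast
  define f where "f = smult (inverse (lead_coeff d)) d"
  have f: "f \<noteq> 0" "lead_coeff f = 1" "ac_eval f x = 0" "degree f = degree d"
    using d by (simp_all add: f_def)
  have dvd: "f dvd g" if "ac_eval g x = 0" for g
  proof -
    have "ac_eval (g mod f) x = 0"
      using that f(3) by (simp flip: minus_div_mult_eq_mod)
    moreover have "g mod f = 0 \<or> degree (g mod f) < degree d"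
      using degree_mod_less[OF f(1), of g] f(4) by simp
    ultimately have "g mod f = 0"
      using min by fastforce
    thus ?thesis by (simp add: mod_eq_0_iff_dvd)
  qed
  have "irreducible f"
  proof (rule irreducibleI)
    show "\<not> f dvd 1"
    proof
      assume "f dvd 1"
      then obtain k where "1 = f * k" ..
      hence "ac_eval f x * ac_eval k x = 1"
        by (simp flip: ac_eval_mult)
      thus False
        using f(3) by simp
    qed
  next
    fix u v assume uv: "f = u * v"
    hence nz: "u \<noteq> 0" "v \<noteq> 0"
      using f(1) by auto
    hence deg: "degree d = degree u + degree v"
      using uv f(4) by (simp add: degree_mult_eq)
    have "ac_eval u x = 0 \<or> ac_eval v x = 0"
      using uv f(3) by simp
    hence "degree d \<le> degree u \<or> degree d \<le> degree v"
      using nz min by blast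
    thus "u dvd 1 \<or> v dvd 1"
      using deg nz by (auto simp: is_unit_iff_degree)
  qed (fact f)
  thus ?thesis
    using that[of f] f dvd assms(2) by (simp add: irreducible_factors_def)
qed

text \<open>An irreducible polynomial is associated to the minimal polynomial of any of its
  roots.\<close>

lemma irreducible_dvd_of_root:
  assumes "irreducible f" "ac_eval f x = 0" "ac_eval g x = 0"
  shows "f dvd g"
proof -
  have "f \<noteq> 0"
    using assms(1) by (simp add: irreducible_def)
  then obtain d where d: "d \<in> irreducible_factors f" "ac_eval d x = 0"
    "\<And>g. ac_eval g x = 0 \<Longrightarrow> d dvd g"
    using irreducible_factor_with_root assms(2) by metis
  then obtain u where u: "f = d * u" "irreducible d"
    by (auto simp: irreducible_factors_def)
  hence "u dvd 1"
    using irreducibleD[OF assms(1) u(1)] by (auto simp: irreducible_def)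
  hence "f dvd d"
    by (simp add: u(1))
  thus ?thesis
    using d(3)[OF assms(3)] dvd_trans by blast
qed

lemma degree_irreducible_pos: "irreducible (f :: 'a::field poly) \<Longrightarrow> degree f > 0"
  by (auto simp: irreducible_def is_unit_iff_degree)

text \<open>The q^(deg f) polynomials of degree below deg f take distinct values at
  \<open>x\<close>, and all these values are roots of Y^(q^N) - Y.\<close>

lemma degree_le_of_root_fixed:
  fixes f :: "'a::{field,finite} poly"
  assumes CARD: "CARD('a) = CHAR('a) ^ m"
    and "irreducible f" "ac_eval f x = 0"
    and fixed: "((\<lambda>y. y ^ CARD('a)) ^^ N) x = x" and "N > 0"
  shows "degree f \<le> N"
proof -
  let ?q = "CARD('a)" and ?\<phi> = "\<lambda>y :: 'a alg_closure. y ^ CARD('a)"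
  let ?U = "{u :: 'a poly. degree u < degree f}" and ?R = "{y :: 'a alg_closure. y ^ (?q ^ N) = y}"
  have q: "?q > 1"
    using card_mono[of UNIV "{0, 1 :: 'a}"] by simp
  have deg: "degree f > 0"
    using assms(2) by (rule degree_irreducible_pos)
  have \<phi>: "(?\<phi> ^^ n) y = y ^ (?q ^ n)" for n y
    by (induction n) (simp_all flip: power_mult add: mult.commute)
  have comm: "(?\<phi> ^^ n) (ac_eval u y) = ac_eval u ((?\<phi> ^^ n) y)" for n u y
    by (induction n) (simp_all add: ac_eval_power_CARD[OF CARD])
  have qN: "?q ^ N > 1"
    using q \<open>N > 0\<close> by (rule one_less_power)
  define P :: "'a alg_closure poly" where "P = monom 1 (?q ^ N) - monom 1 1"
  have "degree P \<le> ?q ^ N"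
    unfolding P_def using qN by (intro degree_diff_le degree_monom_le order.trans[OF degree_monom_le]) auto
  \<comment> \<open>Since q^N > 1, the two monomials of \<open>P\<close> do not cancel.\<close>
  have "coeff P 1 = -1"
    using q \<open>N > 0\<close> by (simp add: P_def)
  hence "P \<noteq> 0"
    by auto
  have R: "?R = {y. poly P y = 0}"
    by (simp add: P_def poly_monom)
  have "finite ?R"
    unfolding R using \<open>P \<noteq> 0\<close> by (rule poly_roots_finite)
  have "inj_on (\<lambda>u. ac_eval u x) ?U"
  proof (rule inj_onI)
    fix u v assume uv: "u \<in> ?U" "v \<in> ?U" "ac_eval u x = ac_eval v x"
    hence "f dvd u - v"
      by (intro irreducible_dvd_of_root[OF assms(2,3)]) simp
    moreover have "degree (u - v) < degree f"
      using uv deg by (intro degree_diff_less) auto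
    ultimately show "u = v"
      using dvd_imp_degree_le[of f "u - v"] by auto
  qed
  moreover have "(\<lambda>u. ac_eval u x) ` ?U \<subseteq> ?R"
    using comm[where n = N and y = x] fixed by (auto simp: \<phi>)
  ultimately have "card ?U \<le> card ?R"
    using \<open>finite ?R\<close> by (rule card_inj_on_le)
  also have "card ?R \<le> ?q ^ N"
    unfolding R using card_poly_roots_bound[OF \<open>P \<noteq> 0\<close>] \<open>degree P \<le> ?q ^ N\<close> by linarith
  finally have "?q ^ degree f \<le> ?q ^ N"
    using deg by (simp add: card_poly_degree_less)
  thus ?thesis
    using q by simp
qed

section \<open>Counting irreducible factors\<close>

lemma finite_irreducible_factors:
  fixes F :: "'a::{field,finite} poly"
  assumes "F \<noteq> 0"
  shows "finite (irreducible_factors F)"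
proof (rule finite_subset)
  show "irreducible_factors F \<subseteq> {f. degree f < Suc (degree F)}"
    using assms by (auto simp: irreducible_factors_def less_Suc_eq_le dvd_imp_degree_le)
qed (rule finite_poly_degree_less)

text \<open>Each root of \<open>F\<close> is a root of some monic irreducible factor, and a factor
  has at most as many roots as its degree.\<close>

lemma card_roots_le_sum_degree:
  fixes F :: "'a::{field,finite} poly"
  assumes "F \<noteq> 0"
  shows "card {x. ac_eval F x = 0} \<le> (\<Sum>f\<in>irreducible_factors F. degree f)"
proof -
  let ?I = "irreducible_factors F"
  have nz: "f \<noteq> 0" if "f \<in> ?I" for f
    using that by (auto simp: irreducible_factors_def)
  have fin: "finite ?I"
    using assms by (rule finite_irreducible_factors)
  have "{x. ac_eval F x = 0} \<subseteq> (\<Union>f\<in>?I. {x. ac_eval f x = 0})"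
  proof safe
    fix x assume "ac_eval F x = 0"
    with assms obtain f where "f \<in> ?I" "ac_eval f x = 0"
      by (rule irreducible_factor_with_root)
    thus "x \<in> (\<Union>f\<in>?I. {x. ac_eval f x = 0})"
      by blast
  qed
  hence "card {x. ac_eval F x = 0} \<le> card (\<Union>f\<in>?I. {x. ac_eval f x = 0})"
    using fin nz by (intro card_mono finite_UN_I finite_ac_eval_roots) auto
  also have "\<dots> \<le> (\<Sum>f\<in>?I. card {x. ac_eval f x = 0})"
    using fin by (rule card_UN_le)
  also have "\<dots> \<le> (\<Sum>f\<in>?I. degree f)"
    using nz by (intro sum_mono card_ac_eval_roots_le)
  finally show ?thesis .
qed

text \<open>
  With \<open>j = n div (2q)\<close> there are at most \<open>q\<^bsup>j+1\<^esup> = O(2\<^bsup>n/2\<^esup>)\<close> polynomials of degree at most \<open>j\<close>,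
  a negligible part of the total degree; all other members of \<open>S\<close> have degree at least \<open>n/(2q)\<close>.
\<close>
lemma card_polys_mult_le_sum_degree:
  fixes S :: "'a::{field,finite} poly set"
  assumes "finite S" "2 ^ n \<le> (\<Sum>f\<in>S. degree f)"
  shows "card S * n \<le> 4 * CARD('a) * (\<Sum>f\<in>S. degree f)"
proof -
  define q j h D where "q = CARD('a)" and "j = n div (2 * q)" and "h = n div 2"
    and "D = (\<Sum>f\<in>S. degree f)"
  let ?L = "{f :: 'a poly. degree f < Suc j}" and ?B = "{f\<in>S. Suc j \<le> degree f}"
  have "q > 0"
    by (simp add: q_def)
  have "card S \<le> card (?L \<union> ?B)"
    using assms(1) finite_poly_degree_less[of "Suc j"] by (intro card_mono) auto
  also have "\<dots> \<le> card ?L + card ?B"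
    by (rule card_Un_le)
  also have "card ?L = q ^ Suc j"
    by (simp only: card_poly_degree_less q_def)
  finally have "card S * n \<le> (q ^ Suc j + card ?B) * n"
    by (rule mult_le_mono1)
  hence S: "card S * n \<le> q ^ Suc j * n + card ?B * n"
    by (simp only: add_mult_distrib)
  have "card ?B * Suc j \<le> (\<Sum>f\<in>?B. degree f)"
    using sum_mono[of ?B "\<lambda>_. Suc j" degree] by simp
  also have "\<dots> \<le> D"
    unfolding D_def using assms(1) by (intro sum_mono2) auto
  finally have B: "card ?B * Suc j \<le> D" .
  have "n \<le> 2 * q * Suc j"
    using dividend_less_times_div[of "2 * q" n] \<open>q > 0\<close> by (simp add: j_def)
  hence "card ?B * n \<le> card ?B * (2 * q * Suc j)"
    by (rule mult_le_mono2)
  also have "\<dots> = 2 * q * (card ?B * Suc j)"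
    by (simp only: mult_ac)
  also have "\<dots> \<le> 2 * q * D"
    using B by (rule mult_le_mono2)
  finally have B': "card ?B * n \<le> 2 * q * D" .
  have "q * j \<le> h"
  proof -
    have "2 * (q * j) \<le> n"
      using times_div_less_eq_dividend[of "2 * q" n] by (simp add: j_def mult.assoc)
    thus ?thesis by (simp add: h_def)
  qed
  \<comment> \<open>From q < 2^q and qj \<le> h, the few small polynomials number at most q 2^h; the
    other half of the exponent absorbs the factor n.\<close>
  have "q ^ j \<le> (2 ^ q) ^ j"
    by (rule power_mono[OF less_imp_le[OF less_exp]]) simp
  also have "\<dots> \<le> 2 ^ h"
    using \<open>q * j \<le> h\<close> by (simp flip: power_mult)
  finally have qj: "q ^ j \<le> 2 ^ h" .
  have "n \<le> 2 * 2 ^ h"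
  proof -
    have "h < 2 ^ h" by (rule less_exp)
    moreover have "n \<le> 2 * h + 1"
      by (simp add: h_def)
    ultimately show ?thesis by linarith
  qed
  hence "q ^ j * n \<le> 2 ^ h * (2 * 2 ^ h)"
    by (rule mult_le_mono[OF qj])
  also have "\<dots> = 2 * 2 ^ (h + h)"
    by (simp add: power_add)
  also have "\<dots> \<le> 2 * 2 ^ n"
    by (intro mult_le_mono2 power_increasing) (auto simp: h_def)
  also have "\<dots> \<le> 2 * D"
    using assms(2) by (simp add: D_def)
  finally have "q ^ Suc j * n \<le> 2 * q * D"
    by (simp add: mult.left_commute mult.assoc)
  \<comment> \<open>Small and large degrees contribute at most 2qD each.\<close>
  thus ?thesis
    using S B' unfolding q_def[symmetric] D_def[symmetric] by linarith
qed

section \<open>Additive polynomials\<close>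

text \<open>Write A = X^j r with r(0) nonzero. If r were constant, additivity would make j a power
  of p, which is excluded; so r has a root, and it is nonzero.\<close>

lemma additive_poly_nonzero_root:
  fixes A :: "'a::{field,finite} poly"
  assumes "additive_poly A" and nonmono: "\<not> (\<exists>a h. A = monom a (CHAR('a) ^ h))"
  obtains k where "k \<noteq> 0" "ac_eval A k = 0"
proof -
  have "A \<noteq> 0"
    using nonmono by (metis monom_eq_0)
  then obtain r where r: "A = [:-0, 1:] ^ order 0 A * r" "\<not> [:-0, 1:] dvd r"
    using order_decomp by blast
  let ?j = "order 0 A"
  have A: "A = monom 1 ?j * r"
    using r(1) by (simp add: monom_altdef)
  have r0: "coeff r 0 \<noteq> 0"
    using r(2) poly_eq_0_iff_dvd[of r 0] by (simp add: poly_0_coeff_0)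
  have "degree r > 0"
  proof (rule ccontr)
    assume "\<not> degree r > 0"
    then obtain c where "r = [:c:]"
      by (auto elim: degree_eq_zeroE)
    hence Ac: "A = monom c ?j" and "c \<noteq> 0"
      using A r0 by (simp_all add: smult_monom)
    have "(x + y) ^ ?j = x ^ ?j + y ^ ?j" for x y :: "'a alg_closure"
      using additive_poly_ac_eval[OF assms(1), of x y] \<open>c \<noteq> 0\<close>
      by (subst (asm) (1 2 3) Ac) (simp add: ac_eval_monom flip: distrib_left)
    hence "\<exists>h. ?j = CHAR('a) ^ h"
      using additive_power_imp_CHAR_power[where 'a = "'a alg_closure"] prime_CHAR_finite[where 'a = 'a]
      by simp
    thus False
      using Ac nonmono by metis
  qed
  then obtain k where k: "ac_eval r k = 0"
    using ac_eval_surj by blast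
  have "k \<noteq> 0"
    using k r0 by (cases r) auto
  moreover have "ac_eval A k = 0"
    using k by (subst A) simp
  ultimately show ?thesis
    using that by blast
qed

lemma degree_poly_iterate: "degree (poly_iterate F n) = degree F ^ n"
  by (induction n) (simp_all add: poly_iterate_def degree_pcompose)

text \<open>Every \<open>y\<close> has the two distinct preimages \<open>s y\<close> and
  \<open>s y + k\<close> under \<open>A + b\<close>, so each pullback at least doubles the number of
  roots.\<close>

lemma card_roots_poly_iterate_ge:
  fixes A :: "'a::{field,finite} poly"
  assumes "additive_poly A" "degree (A + [:b:]) > 0" "k \<noteq> 0" "ac_eval A k = 0"
  shows "2 ^ n \<le> card {x. ac_eval (poly_iterate (A + [:b:]) n) x = 0}"
proof -
  let ?G = "ac_eval (A + [:b:])"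
  let ?R = "\<lambda>n. {x. (?G ^^ n) x = 0}"
  have R: "{x. ac_eval (poly_iterate (A + [:b:]) n) x = 0} = ?R n" for n
    by (simp add: ac_eval_poly_iterate)
  have fin: "finite (?R n)" for n
  proof -
    have "poly_iterate (A + [:b:]) n \<noteq> 0"
      using assms(2) degree_poly_iterate[of "A + [:b:]" n] by (intro notI) simp
    thus ?thesis
      using finite_ac_eval_roots R by metis
  qed
  obtain s where s: "?G (s y) = y" for y
    using ac_eval_surj[OF assms(2)] by metis
  have G: "?G (s y + t) = y" if "t = 0 \<or> t = k" for y t
    using that s[of y] assms(4) additive_poly_ac_eval[OF assms(1), of "s y" k]
    by (elim disjE) simp_all
  have "2 ^ n \<le> card (?R n)"
  proof (induction n)
    case (Suc n)
    let ?g = "\<lambda>(y, t). s y + t"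
    have "card (?R n \<times> {0, k}) \<le> card (?R (Suc n))"
    proof (rule card_inj_on_le)
      show "inj_on ?g (?R n \<times> {0, k})"
      proof (rule inj_onI)
        fix u v assume uv: "u \<in> ?R n \<times> {0, k}" "v \<in> ?R n \<times> {0, k}" "?g u = ?g v"
        obtain y t y' t' where [simp]: "u = (y, t)" "v = (y', t')"
          by (metis surj_pair)
        have "y = y'"
          using uv G[of t y] G[of t' y'] by auto
        thus "u = v"
          using uv by auto
      qed
      show "?g ` (?R n \<times> {0, k}) \<subseteq> ?R (Suc n)"
        by (auto simp: funpow_Suc_right G s simp del: funpow.simps ac_eval_add)
    qed (rule fin)
    moreover have "card (?R n \<times> {0, k}) = 2 * card (?R n)"
      using assms(3) by (simp add: card_cartesian_product)
    ultimately show ?case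
      using Suc.IH unfolding power_Suc by linarith
  qed auto
  thus ?thesis
    by (simp only: R)
qed

text \<open>The constant is \<open>C = e * p\<close>: some positive number \<open>e\<close> of
  Frobenius steps fixes ker A pointwise, and rounding n + 1 up to a power of p costs at most the
  factor p relative to n.\<close>

lemma degree_irreducible_factor_poly_iterate_le:
  fixes A :: "'a::{field,finite} poly"
  assumes CARD: "CARD('a) = CHAR('a) ^ m" and A: "additive_poly A" "A \<noteq> 0"
  obtains C where "C > 0"
    "\<And>n f. n \<ge> 1 \<Longrightarrow> f \<in> irreducible_factors (poly_iterate (A + [:b:]) n) \<Longrightarrow> degree f \<le> C * n"
proof -
  let ?p = "CHAR('a)" and ?B = "A + [:b:]"
  let ?\<phi> = "\<lambda>y :: 'a alg_closure. y ^ CARD('a)" and ?V = "{x. ac_eval A x = 0}"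
  have p: "prime ?p"
    by (rule prime_CHAR_finite)
  have inj: "inj ?\<phi>"
    using power_CHAR_power_inj[where 'a = "'a alg_closure" and k = m] p by (auto simp: CARD inj_def)
  have comm: "ac_eval f (?\<phi> x) = ?\<phi> (ac_eval f x)" for f x
    by (simp add: ac_eval_power_CARD[OF CARD])
  have "?\<phi> ` ?V \<subseteq> ?V"
    by (auto simp: comm)
  then obtain e where e: "e > 0" "\<And>v. ac_eval A v = 0 \<Longrightarrow> (?\<phi> ^^ e) v = v"
    using finite_inj_on_funpow_id[of ?V ?\<phi>] finite_ac_eval_roots[OF A(2)] inj_on_subset[OF inj]
    by blast
  let ?\<sigma> = "?\<phi> ^^ e"
  have \<sigma>_comm: "ac_eval f (?\<sigma> x) = ?\<sigma> (ac_eval f x)" for f x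
    using comm by (induction e) simp_all
  have \<sigma>_0: "?\<sigma> 0 = 0"
    by (induction e) simp_all
  have "?\<phi> (x + y) = ?\<phi> x + ?\<phi> y" for x y
    using p by (intro freshmans_dream'[where n = m]) (simp_all add: CARD)
  hence \<sigma>_add: "?\<sigma> (x + y) = ?\<sigma> x + ?\<sigma> y" for x y
    by (induction e) simp_all
  \<comment> \<open>The constant b cancels in every difference B(x) - B(y) = A(x - y).\<close>
  have diff: "(ac_eval ?B ^^ n) x - (ac_eval ?B ^^ n) y = (ac_eval A ^^ n) (x - y)" for n x y
    by (induction n) (simp_all add: additive_diff[OF additive_poly_ac_eval[OF A(1)], symmetric])
  have bound: "degree f \<le> e * ?p * n"
    if n: "n \<ge> 1" and f: "f \<in> irreducible_factors (poly_iterate ?B n)" for n f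
  proof -
    have irr: "irreducible f" and fdvd: "f dvd poly_iterate ?B n"
      using f by (auto simp: irreducible_factors_def)
    obtain x where x: "ac_eval f x = 0"
      using ac_eval_surj degree_irreducible_pos[OF irr] by blast
    have root: "(ac_eval ?B ^^ n) x = 0"
      using fdvd x by (auto simp: dvd_def simp flip: ac_eval_poly_iterate)
    \<comment> \<open>The exponent is n + 1, not n, because (\<sigma> - 1)^n will annihilate
      \<open>\<sigma> x - x\<close> rather than \<open>x\<close>.\<close>
    have "\<exists>k. n + 1 \<le> ?p ^ k \<and> ?p ^ k \<le> ?p * n"
    proof -
      obtain k where "?p ^ k \<le> n" "n < ?p ^ (k + 1)"
        using ex_power_ivl1[of ?p n] n prime_ge_2_nat[OF p] by blast
      thus ?thesis
        by (intro exI[of _ "k + 1"]) auto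
    qed
    then obtain k where k: "n + 1 \<le> ?p ^ k" "?p ^ k \<le> ?p * n"
      by blast
    have "(ac_eval A ^^ n) (?\<sigma> x - x) = (ac_eval ?B ^^ n) (?\<sigma> x) - (ac_eval ?B ^^ n) x"
      by (simp only: diff)
    \<comment> \<open>\<sigma> permutes the roots of the iterate, whose coefficients lie in the base
      field.\<close>
    also have "(ac_eval ?B ^^ n) (?\<sigma> x) = ?\<sigma> ((ac_eval ?B ^^ n) x)"
      by (simp only: \<sigma>_comm flip: ac_eval_poly_iterate)
    also have "?\<sigma> ((ac_eval ?B ^^ n) x) = (ac_eval ?B ^^ n) x"
      by (simp only: root \<sigma>_0)
    finally have "(ac_eval A ^^ n) (?\<sigma> x - x) = 0"
      by (simp only: diff_self)
    hence "((\<lambda>y. ?\<sigma> y - y) ^^ n) (?\<sigma> x - x) = 0"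
      by (rule funpow_kernel_nilpotent[rotated 3]) (simp_all add: additive_poly_ac_eval[OF A(1)] \<sigma>_comm e(2))
    hence "((\<lambda>y. ?\<sigma> y - y) ^^ (n + 1)) x = 0"
      by (simp add: funpow_Suc_right del: funpow.simps)
    hence "(?\<sigma> ^^ (CHAR('a alg_closure) ^ k)) x = x"
      using p \<sigma>_add k(1) by (intro funpow_CHAR_power_fixed) simp_all
    hence "(?\<sigma> ^^ (?p ^ k)) x = x"
      by simp
    hence "(?\<phi> ^^ (e * ?p ^ k)) x = x"
      by (simp only: funpow_mult)
    moreover have "e * ?p ^ k > 0"
      using e(1) prime_gt_0_nat[OF p] by simp
    ultimately have "degree f \<le> e * ?p ^ k"
      by (rule degree_le_of_root_fixed[OF CARD irr x])
    also have "\<dots> \<le> e * (?p * n)"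
      using k(2) by (rule mult_le_mono2)
    finally show ?thesis
      by (simp add: mult.assoc)
  qed
  show ?thesis
    using e(1) prime_gt_0_nat[OF p] bound by (intro that[of "e * ?p"]) auto
qed

theorem theorem1p6:
  fixes A :: "'a::{field,finite} poly" and b :: 'a and p q m :: nat
  assumes "prime p" and "m \<ge> 1" and "q = p ^ m" and "CARD('a) = q"
    and "additive_poly A"
    and "\<not> (\<exists>(a::'a) (h::nat). A = monom a (p ^ h))"
  shows "\<exists>\<alpha> \<beta> :: real. \<alpha> > 0 \<and> \<beta> > 0 \<and>
    (\<forall>n::nat. n \<ge> 1 \<longrightarrow> avg_factor_degree (A + [:b:]) n / real n \<in> {\<alpha>..\<beta>})"
proof -
  let ?B = "A + [:b:]"
  have p: "CHAR('a) = p"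
    using assms(1,3,4) CHAR_eq_of_CARD by metis
  have "A \<noteq> 0"
    using assms(6) by (metis monom_eq_0)
  obtain k where k: "k \<noteq> 0" "ac_eval A k = 0"
    using additive_poly_nonzero_root[OF assms(5)] assms(6) p by metis
  have "degree A > 0"
  proof (rule ccontr)
    assume "\<not> degree A > 0"
    then obtain a where "A = [:a:]"
      by (auto elim: degree_eq_zeroE)
    thus False
      using k(2) \<open>A \<noteq> 0\<close> by simp
  qed
  hence degB: "degree ?B > 0"
    by (subst degree_add_eq_left) auto
  obtain C where C: "C > 0"
    "\<And>n f. n \<ge> 1 \<Longrightarrow> f \<in> irreducible_factors (poly_iterate ?B n) \<Longrightarrow> degree f \<le> C * n"
    using degree_irreducible_factor_poly_iterate_le[OF _ assms(5) \<open>A \<noteq> 0\<close>, of m b] assms(3,4) p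
    by metis
  have "q > 0"
    using assms(4) by (metis zero_less_card_finite)
  \<comment> \<open>With D the total degree and I the set of factors, the quotient is D / (|I| n).
    The bound |I| n \<le> 4qD gives the lower constant, and D \<le> |I| C n the upper one.\<close>
  have main: "avg_factor_degree ?B n / real n \<in> {1 / (4 * real q)..real C}" if n: "n \<ge> 1" for n
  proof -
    define I where "I = irreducible_factors (poly_iterate ?B n)"
    define D where "D = (\<Sum>f\<in>I. degree f)"
    have nz: "poly_iterate ?B n \<noteq> 0"
      using degB degree_poly_iterate[of ?B n] by (intro notI) simp
    have fin: "finite I"
      unfolding I_def using nz by (rule finite_irreducible_factors)
    have D: "2 ^ n \<le> D"
      using card_roots_poly_iterate_ge[OF assms(5) degB k] card_roots_le_sum_degree[OF nz]
      unfolding D_def I_def by (rule order.trans)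
    \<comment> \<open>This excludes an empty \<open>I\<close>, so the average is a genuine quotient
      and not division by zero.\<close>
    have "D \<noteq> 0"
      using D by (metis le_zero_eq power_not_zero zero_neq_numeral)
    hence "card I > 0"
      using fin by (auto simp: D_def card_gt_0_iff)
    have "card I * n \<le> 4 * q * D"
      using card_polys_mult_le_sum_degree[OF fin] D assms(4) by (simp add: D_def)
    hence low: "real (card I) * real n \<le> 4 * real q * real D"
      by (metis of_nat_le_iff of_nat_mult of_nat_numeral)
    have "D \<le> card I * (C * n)"
      using sum_bounded_above[of I degree "C * n"] C(2)[OF n] by (simp add: D_def I_def)
    hence up: "real D \<le> real (card I) * (real C * real n)"
      by (metis of_nat_le_iff of_nat_mult)
    have avg: "avg_factor_degree ?B n / real n = real D / (real (card I) * real n)"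
      by (simp add: avg_factor_degree_def num_irreducible_factors_def D_def I_def)
    show ?thesis
      unfolding avg using low up \<open>q > 0\<close> \<open>card I > 0\<close> n
      by (auto simp: field_simps)
  qed
  have "1 / (4 * real q) > 0" "real C > 0"
    using \<open>q > 0\<close> C(1) by simp_all
  with main show ?thesis
    by blast
qed

end
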